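(* For every tournament $T$ and every integer $t \ge 1$ with $\vec{\omega}(T) \ge t$, we have $|V(T)| \ge \binom{t+1}{2}$.
   Context: A tournament is a finite directed graph $T$ such that for each pair of distinct vertices $u,w$ exactly one of $(u,w)$, $(w,u)$ is an arc. For a linear order $\ll$ on $V(T)$, the backedge graph $T^{\ll}$ is the undirected graph with vertex set $V(T)$ in which $\{u,w\}$ is an edge if and only if $(u,w)$ is an arc of $T$ and $w \ll u$. The directed clique number is $\vec{\omega}(T) = \min_{\ll} \omega(T^{\ll})$, the minimum over all linear orders $\ll$ on $V(T)$ of the clique number of the backedge graph. *)

theory Defs
  imports "Graph_Theory.Pair_Digraph" "HOL-Library.Ramsey"
begin

locale tournament = pair_digraph T for T :: "'a pair_pre_digraph" +
  assumes exactly_one_arc: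
    "\<And>u w. \<lbrakk>u \<in> pverts T; w \<in> pverts T; u \<noteq> w\<rbrakk> \<Longrightarrow>
       ((u, w) \<in> parcs T) \<noteq> ((w, u) \<in> parcs T)"

text \<open>Linear orders are represented by their strict part, as a relation contained in
  \<open>V \<times> V\<close>: the inclusion is stated because the library predicate does not imply it.\<close>

definition strict_linear_orders :: "'a set \<Rightarrow> 'a rel set" where
  "strict_linear_orders V = {r. r \<subseteq> V \<times> V \<and> strict_linear_order_on V r}"

definition backedges :: "'a pair_pre_digraph \<Rightarrow> 'a rel \<Rightarrow> 'a set set" where
  "backedges T r = {{u, w} | u w. (u, w) \<in> parcs T \<and> (w, u) \<in> r}"

definition clique_number :: "'a set \<Rightarrow> 'a set set \<Rightarrow> nat" where
  "clique_number V E = Max {card K | K. K \<subseteq> V \<and> clique K E}"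

definition directed_clique_number :: "'a pair_pre_digraph \<Rightarrow> nat" where
  "directed_clique_number T =
     Min {clique_number (pverts T) (backedges T r) | r. r \<in> strict_linear_orders (pverts T)}"

text \<open>The maximum and the minimum above range over finite nonempty sets.\<close>

lemma clique_cards_finite_nonempty:
  assumes "finite V"
  shows "finite {card K | K. K \<subseteq> V \<and> clique K E}" and "{card K | K. K \<subseteq> V \<and> clique K E} \<noteq> {}"
proof -
  have "{card K | K. K \<subseteq> V \<and> clique K E} \<subseteq> card ` Pow V" by auto
  then show "finite {card K | K. K \<subseteq> V \<and> clique K E}"
    using assms by (meson finite_Pow_iff finite_imageI finite_subset)
  have "{} \<subseteq> V \<and> clique {} E" by simp
  then show "{card K | K. K \<subseteq> V \<and> clique K E} \<noteq> {}" by blast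
qed

lemma finite_strict_linear_orders:
  assumes "finite V"
  shows "finite (strict_linear_orders V)"
proof (rule finite_subset)
  show "strict_linear_orders V \<subseteq> Pow (V \<times> V)" by (auto simp: strict_linear_orders_def)
qed (use assms in simp)

lemma strict_linear_orders_nonempty: "strict_linear_orders V \<noteq> {}"
proof -
  obtain r where r: "well_order_on V r" using well_order_on by blast
  then have "r - Id \<in> strict_linear_orders V"
    using strict_linear_order_on_diff_Id[of V r]
    by (auto simp: strict_linear_orders_def order_on_defs)
  then show ?thesis by blast
qed

lemma directed_clique_number_finite_nonempty:
  assumes "finite (pverts T)"
  shows "finite {clique_number (pverts T) (backedges T r) | r. r \<in> strict_linear_orders (pverts T)}"
    and "{clique_number (pverts T) (backedges T r) | r. r \<in> strict_linear_orders (pverts T)} \<noteq> {}"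
  using finite_strict_linear_orders[OF assms] strict_linear_orders_nonempty[of "pverts T"] by auto

end

theory Submission
  imports Defs
begin

text \<open>Any ordering of a tournament with directed clique number at least \<open>t + 1\<close> has a backedge
  clique \<open>K\<close> of size at least \<open>t + 1\<close>. Reversing the order on \<open>K\<close> leaves no backedge inside \<open>K\<close>, so
  putting the reversed \<open>K\<close> in front of an arbitrary ordering of the other vertices raises the clique
  number by at most one. Hence the other vertices span a tournament with directed clique number at
  least \<open>t\<close>, and induction gives \<open>|V| \<ge> (t + 1) + t + \<dots> + 1\<close>.\<close>

lemma clique_number_ge_iff:
  assumes "finite V"
  shows "t \<le> clique_number V E \<longleftrightarrow> (\<exists>K \<subseteq> V. clique K E \<and> t \<le> card K)"
  unfolding clique_number_def
  using Max_ge_iff[OF clique_cards_finite_nonempty[OF assms], of t E] by auto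

lemma directed_clique_number_le:
  assumes "finite (pverts T)" and "r \<in> strict_linear_orders (pverts T)"
  shows "directed_clique_number T \<le> clique_number (pverts T) (backedges T r)"
  unfolding directed_clique_number_def
  using directed_clique_number_finite_nonempty(1)[OF assms(1)] assms(2)
  by (intro Min_le) auto

lemma strict_linear_orders_iff:
  "r \<in> strict_linear_orders V \<longleftrightarrow>
     r \<subseteq> V \<times> V \<and> trans r \<and> irrefl r \<and> total_on V r"
  by (auto simp: strict_linear_orders_def strict_linear_order_on_def)

definition prepend_reversed :: "'a set \<Rightarrow> 'a rel \<Rightarrow> 'a set \<Rightarrow> 'a rel \<Rightarrow> 'a rel" where
  "prepend_reversed K r W s = (r\<inverse> \<inter> K \<times> K) \<union> K \<times> W \<union> s"

text \<open>The relation is the ordinal sum of two linear orders on disjoint sets: the converse of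
  \<open>r\<close> on \<open>K\<close>, followed by \<open>s\<close> on
  \<open>V - K\<close>.\<close>

lemma prepend_reversed_strict_linear_order:
  assumes r: "r \<in> strict_linear_orders V" and "K \<subseteq> V"
    and s: "s \<in> strict_linear_orders (V - K)"
  shows "prepend_reversed K r (V - K) s \<in> strict_linear_orders V"
proof -
  have "trans r" "irrefl r" "total_on V r" using r by (auto simp: strict_linear_orders_iff)
  moreover have "s \<subseteq> (V - K) \<times> (V - K)" "trans s" "irrefl s" "total_on (V - K) s"
    using s by (auto simp: strict_linear_orders_iff)
  ultimately show ?thesis
    unfolding strict_linear_orders_iff
    using \<open>K \<subseteq> V\<close>
    apply (intro conjI)
    subgoal by (auto simp: prepend_reversed_def)
    subgoal
      unfolding trans_def prepend_reversed_def by blast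
    subgoal by (auto simp: irrefl_def prepend_reversed_def)
    subgoal by (auto simp: total_on_def prepend_reversed_def)
    done
qed

lemma backedge_iff:
  "{u, w} \<in> backedges T r \<longleftrightarrow>
     (u, w) \<in> parcs T \<and> (w, u) \<in> r \<or> (w, u) \<in> parcs T \<and> (u, w) \<in> r"
  unfolding backedges_def by (auto simp: doubleton_eq_iff)

text \<open>Outside \<open>K\<close> the new order is \<open>s\<close>, so the backedges there are
  those of \<open>s\<close>. Inside \<open>K\<close> every arc runs against \<open>r\<close>, hence
  along the reversed order, and no backedge remains.\<close>

lemma clique_prepend_reversed:
  assumes asym: "asym (parcs T)" and r: "r \<in> strict_linear_orders V"
    and K: "clique K (backedges T r)"
    and s: "s \<in> strict_linear_orders (V - K)"
    and L: "L \<subseteq> V" "clique L (backedges T (prepend_reversed K r (V - K) s))"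
  shows "clique (L - K) (backedges T s)" and "\<exists>x. L \<inter> K \<subseteq> {x}"
proof -
  have sub: "s \<subseteq> (V - K) \<times> (V - K)" using s by (auto simp: strict_linear_orders_iff)
  show "clique (L - K) (backedges T s)"
    using L(2) by (auto simp: clique_def backedge_iff prepend_reversed_def)
  have as: "(u, w) \<in> r \<Longrightarrow> (w, u) \<notin> r" for u w
    using r by (auto simp: strict_linear_orders_iff irrefl_def dest: transD)
  have "u = w" if "u \<in> L \<inter> K" "w \<in> L \<inter> K" for u w
  proof (rule ccontr)
    assume "u \<noteq> w"
    then have "{u, w} \<in> backedges T r"
      "{u, w} \<in> backedges T (prepend_reversed K r (V - K) s)"
      using that K L(2) by (auto simp: clique_def)
    \<comment> \<open>Within \<open>K\<close> the new order is the converse of \<open>r\<close>, so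
      the two edges force either opposite arcs or opposite pairs of \<open>r\<close>.\<close>
    then show False
      using that sub asym as by (auto simp: backedge_iff prepend_reversed_def dest: asymD)
  qed
  then show "\<exists>x. L \<inter> K \<subseteq> {x}" by blast
qed

text \<open>Since \<open>r\<close> lies in \<open>V \<times> V\<close>, \<open>backedges T r\<close>
  is already the backedge graph of the subtournament on \<open>V\<close>. The induction can thus
  shrink \<open>V\<close> while \<open>T\<close> stays fixed.\<close>

lemma card_ge_if_all_orders_have_clique:
  assumes "asym (parcs T)" and "finite V"
    and "\<And>r. r \<in> strict_linear_orders V \<Longrightarrow>
           \<exists>K \<subseteq> V. clique K (backedges T r) \<and> t \<le> card K"
  shows "(t + 1) choose 2 \<le> card V"
  using assms(2,3)
proof (induction t arbitrary: V)
  case 0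
  then show ?case by (simp add: numeral_2_eq_2)
next
  case (Suc t)
  obtain r where r: "r \<in> strict_linear_orders V"
    using strict_linear_orders_nonempty by blast
  then obtain K where K: "K \<subseteq> V" "clique K (backedges T r)" "Suc t \<le> card K"
    using Suc.prems by blast
  have "(t + 1) choose 2 \<le> card (V - K)"
  proof (rule Suc.IH)
    show "finite (V - K)" using Suc.prems by simp
    fix s assume s: "s \<in> strict_linear_orders (V - K)"
    obtain L where L: "L \<subseteq> V" "clique L (backedges T (prepend_reversed K r (V - K) s))"
      "Suc t \<le> card L"
      using Suc.prems(2)[OF prepend_reversed_strict_linear_order[OF r K(1) s]] by blast
    note LK = clique_prepend_reversed[OF assms(1) r K(2) s L(1,2)]
    \<comment> \<open>Passing from \<open>L\<close> to \<open>L - K\<close> costs at most one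
      vertex, which matches the drop from \<open>Suc t\<close> to \<open>t\<close>.\<close>
    have "card (L \<inter> K) \<le> 1"
      using LK(2) card_mono[of "{_}"] by fastforce
    moreover have "card L = card (L \<inter> K) + card (L - K)"
      using finite_subset[OF L(1) Suc.prems(1)] by (rule card_Int_Diff)
    ultimately have "t \<le> card (L - K)" using L(3) by linarith
    then show "\<exists>M \<subseteq> V - K. clique M (backedges T s) \<and> t \<le> card M"
      using LK(1) L(1) by blast
  qed
  moreover have "card V = card K + card (V - K)"
    using K(1) Suc.prems(1) by (metis card_Int_Diff inf.absorb2)
  \<comment> \<open>Pascal's rule: \<open>K\<close> supplies the first summand, \<open>V - K\<close>
    the second.\<close>
  moreover have "(Suc t + 1) choose 2 = Suc t + ((t + 1) choose 2)"
    by (simp add: numeral_2_eq_2)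
  ultimately show ?case using K(3) by linarith
qed

lemma (in tournament) asym_parcs: "asym (parcs T)"
proof (rule asymI)
  fix u w assume "(u, w) \<in> parcs T"
  \<comment> \<open>\<open>exactly_one_arc\<close> speaks of distinct vertices only; the case
    \<open>u = w\<close> is excluded by the absence of loops.\<close>
  moreover from this have "u \<in> pverts T" "w \<in> pverts T" "u \<noteq> w"
    using in_arcsD1 in_arcsD2 no_loops' by auto
  ultimately show "(w, u) \<notin> parcs T" using exactly_one_arc by blast
qed

theorem theorem2:
  fixes T :: "'a pair_pre_digraph" and t :: nat
  assumes "tournament T"
    and "t \<ge> 1"
    and "directed_clique_number T \<ge> t"
  shows "card (pverts T) \<ge> (t + 1) choose 2"
proof -
  interpret tournament T by fact
  show ?thesis
  proof (rule card_ge_if_all_orders_have_clique[OF asym_parcs pair_finite_verts])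
    fix r assume "r \<in> strict_linear_orders (pverts T)"
    then have "t \<le> clique_number (pverts T) (backedges T r)"
      using directed_clique_number_le[of T r] assms(3) by simp
    then show "\<exists>K \<subseteq> pverts T. clique K (backedges T r) \<and> t \<le> card K"
      by (simp add: clique_number_ge_iff)
  qed
qed

end
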